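(* Let $g_1,\dots,g_{m_g}:\mathbb{R}_+^n\to\mathbb{R}$ be increasing functions, let $u_1,\dots,u_{m_g}\in\mathbb{R}$, and let $$\mathcal{G}:=\{x\in\mathbb{R}_+^n: g_i(x)\le u_i\ \text{for all } i\in\{1,\dots,m_g\}\}.$$ Suppose that $\mathcal{G}$ is non-empty and compact (it is a normal set, since the $g_i$ are increasing). Then for any $x\in\mathbb{R}_+^n$ the monotone projection $\pi_{\mathcal{G}}$ satisfies $$\pi_{\mathcal{G}}(x)=\left(\max_{i\in\{1,\dots,m_g\}}\rho_{g_i}(x,u_i)\right)^{-1}x,$$ where $\rho_{g_i}$ denotes the radial inverse of $g_i$.
   Context: $\mathbb{R}_+:=[0,\infty)$; $n,m_g\ge 1$. For vectors $x,x'\in\mathbb{R}^n$, $x\le x'$ means $x_i\le x'_i$ for all $i$. A function $g:\mathbb{R}_+^n\to\mathbb{R}$ is increasing if $g(x)\le g(x')$ whenever $x\le x'$. A set $S\subseteq\mathbb{R}_+^n$ is normal if $x\in S$ and $0\le y\le x$ imply $y\in S$. Monotone projection: for a normal set $S\subseteq\mathbb{R}_+^n$ and $x\in\mathbb{R}_+^n$, $$\pi_S(x):=\alpha_S(x)\,x,\qquad \alpha_S(x):=\sup\{\alpha\in\mathbb{R}_+:\alpha x\in S\}.$$ Radial inverse: for an increasing $g:\mathbb{R}_+^n\to\mathbb{R}$, $\rho_g:\mathbb{R}_+^n\times\mathbb{R}\to\mathbb{R}_+\cup\{\infty\}$ is defined by $\rho_g(x,y):=\inf\{r>0: g(x/r)\le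 y\}$, with $\inf\emptyset=\infty$. Conventions for extended values: $\infty^{-1}=0$, $0^{-1}=\infty$, and $\infty\cdot 0=0$ for the zero vector (this last convention is relevant only for $x=0$, where $\pi_{\mathcal{G}}(0)=0$). *)

theory Defs
  imports "HOL-Analysis.Analysis"
begin

abbreviation nonneg_orthant :: "(real ^ 'n) set"
  where "nonneg_orthant \<equiv> {x. 0 \<le> x}"

definition normal_set :: "(real ^ 'n) set \<Rightarrow> bool"
  where "normal_set S \<longleftrightarrow>
    S \<subseteq> nonneg_orthant \<and> (\<forall>x\<in>S. \<forall>y. 0 \<le> y \<and> y \<le> x \<longrightarrow> y \<in> S)"

text \<open>
  Multiplication of a vector by a factor in \<open>[0, \<infinity>]\<close>. The product with \<open>\<infinity>\<close> has a meaning for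
  the zero vector only; on other vectors it is left unspecified, so that it cannot be confused
  with the product with 0 (as would happen with the bare \<open>enn2real\<close>, where \<open>enn2real \<infinity> = 0\<close>).
\<close>
definition scale_ext :: "ennreal \<Rightarrow> real ^ 'n \<Rightarrow> real ^ 'n"
  where "scale_ext c x =
    (if c = \<infinity> then (if x = 0 then 0 else undefined) else enn2real c *\<^sub>R x)"

text \<open>
  Suprema and infima are taken in \<open>[0, \<infinity>]\<close>: unbounded sets have supremum \<open>\<infinity>\<close>, and the empty
  set has infimum \<open>\<infinity>\<close>. Functions on the orthant are total functions of which only the values
  on the orthant matter: for nonnegative \<open>x\<close>, every point \<open>x /\<^sub>R r\<close> below is nonnegative.
\<close>
definition proj_factor :: "(real ^ 'n) set \<Rightarrow> real ^ 'n \<Rightarrow> ennreal"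
  where "proj_factor S x = (SUP a\<in>{a. 0 \<le> a \<and> a *\<^sub>R x \<in> S}. ennreal a)"

definition monotone_proj :: "(real ^ 'n) set \<Rightarrow> real ^ 'n \<Rightarrow> real ^ 'n"
  where "monotone_proj S x = scale_ext (proj_factor S x) x"

definition radial_inverse :: "(real ^ 'n \<Rightarrow> real) \<Rightarrow> real ^ 'n \<Rightarrow> real \<Rightarrow> ennreal"
  where "radial_inverse g x y = (INF r\<in>{r. 0 < r \<and> g (x /\<^sub>R r) \<le> y}. ennreal r)"

definition feasible_set ::
    "nat \<Rightarrow> (nat \<Rightarrow> real ^ 'n \<Rightarrow> real) \<Rightarrow> (nat \<Rightarrow> real) \<Rightarrow> (real ^ 'n) set"
  where "feasible_set m g u = {x \<in> nonneg_orthant. \<forall>i\<in>{1..m}. g i x \<le> u i}"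

lemma normal_set_feasible_set:
  assumes "\<And>i. i \<in> {1..m} \<Longrightarrow> mono_on nonneg_orthant (g i)"
  shows "normal_set (feasible_set m g u)"
  unfolding normal_set_def
proof (intro conjI ballI allI impI)
  show "feasible_set m g u \<subseteq> nonneg_orthant"
    by (auto simp: feasible_set_def)
next
  fix x y assume x: "x \<in> feasible_set m g u" and y: "0 \<le> y \<and> y \<le> x"
  have "g i y \<le> u i" if i: "i \<in> {1..m}" for i
  proof -
    have "g i y \<le> g i x"
      using mono_onD[OF assms[OF i], of y x] x y by (simp add: feasible_set_def)
    also have "\<dots> \<le> u i"
      using x i by (simp add: feasible_set_def)
    finally show ?thesis .
  qed
  then show "y \<in> feasible_set m g u"
    using y by (simp add: feasible_set_def)
qed

end

theory Submission imports Defs begin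

text \<open>
  The two scaling factors already agree in \<open>[0, \<infinity>]\<close>. For \<open>a > 0\<close>, the point \<open>a x\<close> is feasible
  iff \<open>r = 1 / a\<close> lies in \<open>R\<^sub>i = {r > 0. g\<^sub>i (x / r) \<le> u\<^sub>i}\<close> for every \<open>i\<close>. By monotonicity each
  \<open>R\<^sub>i\<close> is upward closed, so the infimum of the intersection of the \<open>R\<^sub>i\<close> is the maximum of their
  infima, and inversion turns this infimum into the supremum of the admissible factors \<open>a\<close>.
\<close>

lemma ennreal_inverse_antimono:
  fixes a b :: ennreal
  shows "a \<le> b \<Longrightarrow> inverse b \<le> inverse a"
  including ennreal.lifting by transfer (rule ereal_inverse_antimono)

lemma ennreal_inverse_inverse [simp]: "inverse (inverse a) = (a :: ennreal)"
  by (cases a; cases "a = 0") (auto simp: inverse_ennreal ennreal_zero_less_top less_le)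

lemma radial_inverse_le:
  assumes "0 < a" "g (a *\<^sub>R x) \<le> y"
  shows "radial_inverse g x y \<le> inverse (ennreal a)"
  unfolding radial_inverse_def
  \<comment> \<open>The witness is \<open>r = inverse a\<close>, for which
    \<open>x /\<^sub>R r\<close> is \<open>a *\<^sub>R x\<close>.\<close>
  using assms by (intro INF_lower2[of "inverse a"]) (auto simp: inverse_ennreal)

text \<open>The infimum need not be attained, so strictness is what yields an admissible
  \<open>r < inverse a\<close>; monotonicity of \<open>g\<close> then passes from
  \<open>x /\<^sub>R r\<close> down to the smaller point \<open>a *\<^sub>R x\<close>.\<close>

lemma le_of_radial_inverse_less:
  fixes x :: "real ^ 'n"
  assumes g: "mono_on nonneg_orthant g" and x: "0 \<le> x" and a: "0 < a"
    and less: "radial_inverse g x y < inverse (ennreal a)"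
  shows "g (a *\<^sub>R x) \<le> y"
proof -
  obtain r where r: "0 < r" "g (x /\<^sub>R r) \<le> y" and "ennreal r < inverse (ennreal a)"
    using less unfolding radial_inverse_def INF_less_iff by auto
  then have "r < inverse a"
    using a by (simp add: inverse_ennreal ennreal_less_iff)
  then have "a \<le> inverse r"
    using less_imp_inverse_less[of r "inverse a"] r a by simp
  then have "a *\<^sub>R x \<le> x /\<^sub>R r"
    using x by (intro scaleR_right_mono)
  moreover have "0 \<le> a *\<^sub>R x" "0 \<le> x /\<^sub>R r"
    using x a r by (auto intro: scaleR_nonneg_nonneg)
  ultimately have "g (a *\<^sub>R x) \<le> g (x /\<^sub>R r)"
    by (intro mono_onD[OF g]) auto
  with r show ?thesis
    by linarith
qed

lemma proj_factor_feasible_set: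
  fixes x :: "real ^ 'n"
  assumes m: "m \<ge> 1"
    and g: "\<And>i. i \<in> {1..m} \<Longrightarrow> mono_on nonneg_orthant (g i)"
    and x: "0 \<le> x"
  shows "proj_factor (feasible_set m g u) x =
    inverse (MAX i\<in>{1..m}. radial_inverse (g i) x (u i))"
    (is "?P = inverse ?M")
proof (rule antisym)
  show "?P \<le> inverse ?M"
    unfolding proj_factor_def
  proof (rule SUP_least)
    fix a assume a: "a \<in> {a. 0 \<le> a \<and> a *\<^sub>R x \<in> feasible_set m g u}"
    show "ennreal a \<le> inverse ?M"
    \<comment> \<open>The factor 0 corresponds to no finite radius \<open>1 / a\<close>, but its
      bound is trivial.\<close>
    proof (cases "a = 0")
      case False
      then have "?M \<le> inverse (ennreal a)"
        using a m by (auto simp: feasible_set_def intro!: radial_inverse_le)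
      then have "inverse (inverse (ennreal a)) \<le> inverse ?M"
        by (rule ennreal_inverse_antimono)
      then show ?thesis
        by simp
    qed simp
  qed
next
  show "inverse ?M \<le> ?P"
  \<comment> \<open>Taking \<open>t\<close> strictly below \<open>inverse ?M\<close> supplies the
    strict inequality that \<open>le_of_radial_inverse_less\<close> requires, and makes
    \<open>t\<close> finite even if \<open>?M\<close> is 0.\<close>
  proof (rule dense_le)
    fix t assume t: "t < inverse ?M"
    then obtain a where a: "0 \<le> a" "t = ennreal a"
      by (cases t) auto
    show "t \<le> ?P"
    proof (cases "a = 0")
      case False
      with a have "0 < a" by simp
      have "?M < inverse t"
        using t by (metis ennreal_inverse_antimono ennreal_inverse_inverse linorder_not_le)
      then have "radial_inverse (g i) x (u i) < inverse (ennreal a)" if "i \<in> {1..m}" for i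
        using that a by (simp add: Max_less_iff)
      then have "a *\<^sub>R x \<in> feasible_set m g u"
        using g x \<open>0 < a\<close>
        by (auto simp: feasible_set_def scaleR_nonneg_nonneg
            intro: le_of_radial_inverse_less[where g = "g i" for i])
      then show ?thesis
        unfolding proj_factor_def using a by (auto intro!: SUP_upper)
    qed (use a in simp)
  qed
qed

theorem proposition2:
  fixes g :: "nat \<Rightarrow> real ^ 'n \<Rightarrow> real"
    and u :: "nat \<Rightarrow> real"
    and m :: nat
    and x :: "real ^ 'n"
  assumes "m \<ge> 1"
    and "\<And>i. i \<in> {1..m} \<Longrightarrow> mono_on nonneg_orthant (g i)"
    and "feasible_set m g u \<noteq> {}"
    and "compact (feasible_set m g u)"
    and "x \<in> nonneg_orthant"
  shows "monotone_proj (feasible_set m g u) x =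
    scale_ext (inverse (MAX i\<in>{1..m}. radial_inverse (g i) x (u i))) x"
  unfolding monotone_proj_def
  using proj_factor_feasible_set[OF assms(1,2)] assms(5) by simp

end
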